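(* Let $b,c$ be positive integers with $bc\le 3$. Then the canonical basis $\mathcal{B}$ of $\mathcal{A}(b,c)$ is the set of all cluster monomials.
   Context: Let $\mathcal{F}=\mathbb{Q}(y_1,y_2)$ be the field of rational functions in two commuting independent variables. For positive integers $b,c$ define $y_m\in\mathcal{F}$ for all $m\in\mathbb{Z}$ recursively by $y_{m-1}y_{m+1}=y_m^b+1$ for $m$ odd and $y_{m-1}y_{m+1}=y_m^c+1$ for $m$ even. The cluster algebra $\mathcal{A}(b,c)$ is the subring of $\mathcal{F}$ generated by all $y_m$, $m\in\mathbb{Z}$. It is known (Laurent phenomenon) that for each $m\in\mathbb{Z}$ every element of $\mathcal{A}(b,c)$ is uniquely a Laurent polynomial with integer coefficients in $y_m$ and $y_{m+1}$. A cluster monomial is an element of the form $y_m^p y_{m+1}^q$ with $m\in\mathbb{Z}$ and $p,q\in\mathbb{Z}_{\ge0}$. A non-zero element $y\in\mathcal{A}(b,c)$ is called positive if for every $m\in\mathbb{Z}$ all the (non-zero) coefficients in the expansion of $y$ as a Laurent polynomial in $y_m$ and $y_{m+1}$ are positive. When $bc\le 4$, the canonical basis $\mathcal{B}$ is the unique $\mathbb{Z}$-basis of $\mathcal{A}(b,c)$ such that the set of positive elements consists precisely of the positive integer linear combinations of elements of $\mathcal{B}$ (existence and uniqueness is a theorem of the same paper). *)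

theory Defs
  imports
    "HOL-Computational_Algebra.Fraction_Field"
    "HOL-Computational_Algebra.Polynomial"
    "HOL-Library.Poly_Mapping"
begin

text \<open>The field of rational functions \<open>\<rat>(y\<^sub>1, y\<^sub>2)\<close>, as the fraction field of \<open>\<rat>[y\<^sub>1][y\<^sub>2]\<close>.\<close>

type_synonym ratfun = "rat poly poly fract"

definition Y1 :: ratfun where
  "Y1 = Fraction_Field.Fract [:[:0, 1:]:] 1"

definition Y2 :: ratfun where
  "Y2 = Fraction_Field.Fract [:0, 1:] 1"

definition exchange_exp :: "nat \<Rightarrow> nat \<Rightarrow> int \<Rightarrow> nat" where
  "exchange_exp b c m = (if odd m then b else c)"

text \<open>
  The exchange relation, solved for \<open>y\<^sub>m\<close> from \<open>y\<^sub>m\<^sub>-\<^sub>1, y\<^sub>m\<^sub>-\<^sub>2\<close> to the right of the initial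
  cluster and from \<open>y\<^sub>m\<^sub>+\<^sub>1, y\<^sub>m\<^sub>+\<^sub>2\<close> to the left of it. By \<open>cluster_var_nonzero\<close> below, no
  division by zero occurs, so that the relation holds for all \<open>m\<close> (\<open>cluster_var_exchange\<close>).
\<close>

function cluster_var :: "nat \<Rightarrow> nat \<Rightarrow> int \<Rightarrow> ratfun" where
  "cluster_var b c m =
    (if m = 1 then Y1
     else if m = 2 then Y2
     else if m > 2 then
       (cluster_var b c (m - 1) ^ exchange_exp b c (m - 1) + 1) / cluster_var b c (m - 2)
     else
       (cluster_var b c (m + 1) ^ exchange_exp b c (m + 1) + 1) / cluster_var b c (m + 2))"
  by pat_completeness auto
termination
  by (relation "measure (\<lambda>(b, c, m). nat \<bar>2 * m - 3\<bar>)") auto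

declare cluster_var.simps [simp del]

text \<open>
  Nonvanishing uses the library's order on the fraction field of an ordered domain (sign of the
  leading coefficient); that order is unrelated to positivity of elements of the cluster algebra.
\<close>

lemma cluster_var_greater_zero: "cluster_var b c m > 0"
proof (induction b c m rule: cluster_var.induct)
  case (1 b c m)
  have "Y1 > 0" "Y2 > 0"
    by (simp_all only: Y1_def Y2_def Fraction_Field.zero_less_Fract_iff [OF zero_less_one])
      (simp_all add: less_poly_def pos_poly_def)
  with 1 show ?case
    by (subst cluster_var.simps) (auto intro!: divide_pos_pos add_pos_pos)
qed

lemma cluster_var_nonzero: "cluster_var b c m \<noteq> 0"
  using cluster_var_greater_zero [of b c m] by simp

lemma cluster_var_exchange:
  "cluster_var b c (m - 1) * cluster_var b c (m + 1) =
    cluster_var b c m ^ (if odd m then b else c) + 1"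
proof (cases "m \<ge> 2")
  case True
  then have "cluster_var b c (m + 1) =
      (cluster_var b c m ^ exchange_exp b c m + 1) / cluster_var b c (m - 1)"
    by (subst cluster_var.simps) (simp add: algebra_simps)
  then show ?thesis
    using cluster_var_nonzero [of b c "m - 1"] by (simp add: exchange_exp_def)
next
  case False
  then have "cluster_var b c (m - 1) =
      (cluster_var b c m ^ exchange_exp b c m + 1) / cluster_var b c (m + 1)"
    by (subst cluster_var.simps) (simp add: algebra_simps)
  then show ?thesis
    using cluster_var_nonzero [of b c "m + 1"] by (simp add: exchange_exp_def)
qed

inductive_set subring_generated :: "'a::ring_1 set \<Rightarrow> 'a set" for S where
  gen: "x \<in> S \<Longrightarrow> x \<in> subring_generated S"
| one: "1 \<in> subring_generated S"
| diff: "x \<in> subring_generated S \<Longrightarrow> y \<in> subring_generated S \<Longrightarrow> x - y \<in> subring_generated S"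
| mult: "x \<in> subring_generated S \<Longrightarrow> y \<in> subring_generated S \<Longrightarrow> x * y \<in> subring_generated S"

definition cluster_algebra :: "nat \<Rightarrow> nat \<Rightarrow> ratfun set" where
  "cluster_algebra b c = subring_generated (range (cluster_var b c))"

definition cluster_monomials :: "nat \<Rightarrow> nat \<Rightarrow> ratfun set" where
  "cluster_monomials b c =
    {cluster_var b c m ^ p * cluster_var b c (m + 1) ^ q | (m :: int) (p :: nat) (q :: nat). True}"

text \<open>
  A Laurent polynomial in two variables with integer coefficients is a finitely supported map from
  exponent vectors to coefficients; \<open>laurent_eval f u v\<close> is its value at \<open>(u, v)\<close>.
\<close>

definition laurent_eval :: "(int \<times> int \<Rightarrow>\<^sub>0 int) \<Rightarrow> 'a::field \<Rightarrow> 'a \<Rightarrow> 'a" where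
  "laurent_eval f u v =
    (\<Sum>(i, j)\<in>Poly_Mapping.keys f. of_int (Poly_Mapping.lookup f (i, j)) * u powi i * v powi j)"

text \<open>
  The Laurent expansion of an element in \<open>y\<^sub>m, y\<^sub>m\<^sub>+\<^sub>1\<close> is unique, since these two elements are
  algebraically independent; so the existential quantifier speaks about \<^emph>\<open>the\<close> expansion.
\<close>

definition positive_element :: "nat \<Rightarrow> nat \<Rightarrow> ratfun \<Rightarrow> bool" where
  "positive_element b c x \<longleftrightarrow>
    x \<in> cluster_algebra b c \<and> x \<noteq> 0 \<and>
    (\<forall>m. \<exists>f. x = laurent_eval f (cluster_var b c m) (cluster_var b c (m + 1)) \<and>
      (\<forall>k\<in>Poly_Mapping.keys f. Poly_Mapping.lookup f k > 0))"

global_interpretation int_mod: module "\<lambda>(n :: int) (x :: 'a::comm_ring_1). of_int n * x"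
  by unfold_locales (simp_all add: algebra_simps)

definition is_int_basis :: "'a::comm_ring_1 set \<Rightarrow> 'a set \<Rightarrow> bool" where
  "is_int_basis B A \<longleftrightarrow> int_mod.independent B \<and> int_mod.span B = A"

definition positive_combinations :: "'a::comm_ring_1 set \<Rightarrow> 'a set" where
  "positive_combinations B =
    {(\<Sum>v\<in>T. of_int (u v) * v) | T (u :: 'a \<Rightarrow> int).
      finite T \<and> T \<noteq> {} \<and> T \<subseteq> B \<and> (\<forall>v\<in>T. u v > 0)}"

definition is_canonical_basis :: "nat \<Rightarrow> nat \<Rightarrow> ratfun set \<Rightarrow> bool" where
  "is_canonical_basis b c B \<longleftrightarrow>
    is_int_basis B (cluster_algebra b c) \<and>
    {x. positive_element b c x} = positive_combinations B"

end

theory Submission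
  imports Defs "HOL-Computational_Algebra.Polynomial_Factorial"
begin

text \<open>
  Since \<open>b * c \<le> 3\<close>, one of the two exponents is \<open>1\<close>; renumber the cluster variables so that
  even indices carry exponent \<open>1\<close> and odd indices carry an exponent \<open>c \<in> {1, 2, 3}\<close>. The
  argument then rests on three facts.

  \<^item> Straightening. The product of two cluster variables that share no cluster is a sum of products
    that are strictly smaller for a suitable weight, so every product of cluster variables is a
    positive combination of cluster monomials (\<open>straighten\<close>, \<open>product_in_span\<close>). Hence the
    cluster monomials span the cluster algebra. The same product formulas show that the sequence is
    periodic, with period \<open>5\<close>, \<open>6\<close> or \<open>8\<close> (\<open>period_shift\<close>), which leaves finitely
    many cases to look at.

  \<^item> Proper Laurent monomials. Fix a cluster \<open>{u, v}\<close>. A cluster monomial is either a monomial in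
    \<open>u, v\<close>, or a positive Laurent polynomial in \<open>u, v\<close> each of whose monomials has a negative
    exponent (\<open>adjacent_monomial_cases\<close>). For the second case it suffices to find a linear form
    with nonnegative coefficients that is negative on all exponent vectors of the two variables of
    the other cluster, or zero on the one that is \<open>u\<close> or \<open>v\<close> itself. Such a form exists
    because the straightening formulas, solved for a variable, divide only by \<open>u\<close> or \<open>v\<close>:
    they build up each Laurent expansion by additions and by multiplications with Laurent monomials,
    so degrees can be read off without expanding anything.

  \<^item> Algebraic independence of the two variables of every cluster, which passes from a cluster to its
    neighbours (\<open>independent_pair_mutation\<close>) and makes Laurent expansions unique.

  By the last two facts, the coefficient of a cluster monomial \<open>u ^ p * v ^ q\<close> in a linear
  combination \<open>x\<close> of cluster monomials equals the coefficient of that same monomial in the Laurent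
  expansion of \<open>x\<close> in \<open>u, v\<close> (\<open>coefficient_of_cluster_monomial\<close>). This gives linear
  independence at once, and also that positive elements have nonnegative coefficients; conversely,
  positive combinations of cluster monomials are positive because every cluster monomial is. So the
  cluster monomials are a canonical basis. It is the only one, since a basis consists of the
  indecomposable elements of the additive semigroup that it generates
  (\<open>additive_closure_basis_unique\<close>).
\<close>

section \<open>Exchange sequences, product formulas and periodicity\<close>

text \<open>
  For \<open>c = 1, 2, 3\<close> the values belong to the finite types \<open>A\<^sub>2\<close>, \<open>B\<^sub>2\<close> and
  \<open>G\<^sub>2\<close> and count their cluster variables: two initial ones, and one for each positive root.
\<close>

definition period :: "nat \<Rightarrow> int" where
  "period c = (if c = 1 then 5 else if c = 2 then 6 else 8)"

text \<open>
  An abstract copy of the cluster variables. The cluster variables themselves are an instance after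
  a shift of the index that makes the even indices carry the exponent \<open>1\<close>.
\<close>

locale exchange_sequence =
  fixes z :: "int \<Rightarrow> 'a::field" and c :: nat
  assumes nonzero: "z k \<noteq> 0"
    and even_exchange: "even k \<Longrightarrow> z (k - 1) * z (k + 1) = z k + 1"
    and odd_exchange: "odd k \<Longrightarrow> z (k - 1) * z (k + 1) = z k ^ c + 1"
    and c_pos: "c > 0"
begin

text \<open>
  The exchange relations are invariant under translations by even numbers and under reflections that
  preserve parity. These symmetries act transitively on the unordered clusters, so that a statement
  about all clusters needs to be proved only for the cluster of \<open>z 0\<close> and \<open>z 1\<close>.
\<close>

lemma frame:
  assumes "even m" and "s = 1 \<or> s = - 1"
  shows "exchange_sequence (\<lambda>j. z (m + s * j)) c"
proof
  show "z (m + s * k) \<noteq> 0" for k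
    by (rule nonzero)
  show "z (m + s * (k - 1)) * z (m + s * (k + 1)) = z (m + s * k) + 1" if "even k" for k
    using assms(2) even_exchange [of "m + s * k"] that assms(1)
    by (auto simp: algebra_simps)
  show "z (m + s * (k - 1)) * z (m + s * (k + 1)) = z (m + s * k) ^ c + 1" if "odd k" for k
    using assms(2) odd_exchange [of "m + s * k"] that assms(1)
    by (auto simp: algebra_simps)
qed (rule c_pos)

text \<open>
  Multiply \<open>z 0\<close> by the exchange relation at \<open>2\<close>, then replace \<open>z 0 * z 2\<close> and
  \<open>z 0 + 1\<close> by the exchange relations at \<open>1\<close> and \<open>0\<close>: all terms become divisible by
  \<open>z 1\<close>.
\<close>

lemma product_0_3: "z 0 * z 3 = z 1 ^ (c - 1) + z (- 1)"
proof -
  have "z 1 * (z 0 * z 3) = z 0 * z 2 + z 0"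
    using even_exchange [of 2] by (simp add: distrib_left mult.left_commute [of "z 1"])
  also have "\<dots> = z 1 ^ c + (z 0 + 1)"
    using odd_exchange [of 1] by simp
  also have "\<dots> = z 1 * (z 1 ^ (c - 1) + z (- 1))"
    using even_exchange [of 0] c_pos by (cases c) (simp_all add: algebra_simps)
  finally show ?thesis
    using nonzero [of 1] by simp
qed

lemma product_frame_3:
  assumes "even m" and "s = 1 \<or> s = - 1"
  shows "z m * z (m + s * 3) = z (m + s) ^ (c - 1) + z (m - s)"
proof -
  interpret f: exchange_sequence "\<lambda>j. z (m + s * j)" c
    using assms by (rule frame)
  show ?thesis using f.product_0_3 by simp
qed

text \<open>
  This formula and the next one are the two products of variables at distance \<open>4\<close> in type
  \<open>G\<^sub>2\<close>. Their right-hand sides are invariant under the reflections in \<open>1\<close> and in \<open>0\<close>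
  respectively, although the left-hand sides are not visibly so; this forces the period \<open>8\<close>.
\<close>

lemma product_1_5:
  assumes "c = 3"
  shows "z 1 * z 5 = z 3 + z (- 1)"
proof -
  have e2: "z 1 * z 3 = z 2 + 1" and e4: "z 3 * z 5 = z 4 + 1"
    using even_exchange [of 2] even_exchange [of 4] by simp_all
  have o3: "z 2 * z 4 = z 3 ^ 3 + 1"
    using odd_exchange [of 3] assms by simp
  have 1: "z 2 * z (- 1) = z 3 + z 1 ^ 2"
    using product_frame_3 [of 2 "- 1"] assms by (simp add: add.commute)
  have "z 2 * z 3 * (z 1 * z 5) = z 2 * z 3 * (z 3 + z (- 1))"
    using e2 e4 o3 1 by algebra
  then show ?thesis using nonzero [of 2] nonzero [of 3] by simp
qed

lemma product_0_4:
  assumes "c = 3"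
  shows "z 0 * z 4 = z 2 + z (- 2) + 3"
proof -
  have e2: "z 1 * z 3 = z 2 + 1" and e0: "z (- 1) * z 1 = z 0 + 1"
    using even_exchange [of 2] even_exchange [of 0] by simp_all
  have o1: "z 0 * z 2 = z 1 ^ 3 + 1" and o3: "z 2 * z 4 = z 3 ^ 3 + 1"
    and om: "z (- 2) * z 0 = z (- 1) ^ 3 + 1"
    using odd_exchange [of 1] odd_exchange [of 3] odd_exchange [of "- 1"] assms by simp_all
  \<comment> \<open>The factors \<open>z 0\<close>, \<open>z 1 ^ 3\<close> and \<open>z 2\<close> clear the denominators of \<open>z (- 2)\<close>
    and \<open>z 4\<close>.\<close>
  have "z 1 ^ 3 * (z 0 * z 2 * (z 0 * z 4)) = z 1 ^ 3 * (z 0 * z 2 * (z 2 + z (- 2) + 3))"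
    using e2 e0 o1 o3 om by algebra
  then show ?thesis using nonzero [of 1] nonzero [of 0] nonzero [of 2] by simp
qed

lemma product_frame_1_5:
  assumes "even m" and "s = 1 \<or> s = - 1" and "c = 3"
  shows "z (m + s) * z (m + s * 5) = z (m + s * 3) + z (m - s)"
proof -
  interpret f: exchange_sequence "\<lambda>j. z (m + s * j)" c
    using assms(1,2) by (rule frame)
  show ?thesis using f.product_1_5 [OF assms(3)] by simp
qed

lemma product_frame_0_4:
  assumes "even m" and "s = 1 \<or> s = - 1" and "c = 3"
  shows "z m * z (m + s * 4) = z (m + s * 2) + z (m - s * 2) + 3"
proof -
  interpret f: exchange_sequence "\<lambda>j. z (m + s * j)" c
    using assms(1,2) by (rule frame)
  show ?thesis using f.product_0_4 [OF assms(3)] by simp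
qed

text \<open>
  Periodicity follows in each type from two product formulas with the same right-hand side, mostly
  mirror images of each other. The products on the left share a factor, so the other two factors,
  whose indices differ by the period, are equal.
\<close>

lemma period_5:
  assumes "c = 1"
  shows "z (k + 5) = z k"
proof (cases "even k")
  case True
  with product_frame_3 [of "k + 2" 1] even_exchange [of "k + 2"]
  have "z (k + 2) * z (k + 5) = 1 + z (k + 1)"
    by (simp add: assms algebra_simps)
  moreover have "z (k + 2) * z k = z (k + 1) + 1"
    using odd_exchange [of "k + 1"] True by (simp add: assms algebra_simps)
  ultimately show ?thesis
    by (metis add.commute mult_left_cancel nonzero)
next
  case False
  with product_frame_3 [of "k + 3" "- 1"]
  have "z (k + 3) * z k = 1 + z (k + 4)"
    by (simp add: assms algebra_simps)
  moreover have "z (k + 3) * z (k + 5) = z (k + 4) + 1"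
    using odd_exchange [of "k + 4"] False by (simp add: assms algebra_simps)
  ultimately show ?thesis
    by (metis add.commute mult_left_cancel nonzero)
qed


lemma period_6_odd:
  assumes "c = 2" and "odd k"
  shows "z (k + 6) = z k"
proof -
  from product_frame_3 [of "k + 3" "- 1"] product_frame_3 [of "k + 3" 1] assms
  have "z (k + 3) * z k = z (k + 3) * z (k + 6)"
    by (simp add: add.commute)
  then show ?thesis using nonzero [of "k + 3"] by simp
qed

text \<open>
  For even \<open>k\<close> the two right-hand sides agree only up to the period of the odd indices, which is
  known by then.
\<close>

lemma period_6:
  assumes "c = 2"
  shows "z (k + 6) = z k"
proof (cases "even k")
  case True
  have "z (k + 3) * z k = z (k + 1) + z (k - 1)"
    using product_frame_3 [of k 1] True assms by (simp add: mult.commute)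
  moreover have "z (k + 3) * z (k + 6) = z (k + 5) + z (k + 7)"
    using product_frame_3 [of "k + 6" "- 1"] True assms by (simp add: algebra_simps)
  moreover have "z (k + 5) = z (k - 1)" "z (k + 7) = z (k + 1)"
    using period_6_odd [of "k - 1"] period_6_odd [of "k + 1"] True assms by (simp_all add: algebra_simps)
  ultimately show ?thesis
    by (metis add.commute mult_left_cancel nonzero)
qed (simp add: period_6_odd assms)

lemma period_8:
  assumes "c = 3"
  shows "z (k + 8) = z k"
proof (cases "even k")
  case True
  with assms product_frame_0_4 [of "k + 4" 1] product_frame_0_4 [of "k + 4" "- 1"]
  have "z (k + 4) * z k = z (k + 4) * z (k + 8)"
    by (simp add: add.commute)
  then show ?thesis using nonzero [of "k + 4"] by simp
next
  case False
  with assms product_frame_1_5 [of "k + 3" 1] product_frame_1_5 [of "k + 5" "- 1"]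
  have "z (k + 4) * z k = z (k + 4) * z (k + 8)"
    by (simp add: add.commute)
  then show ?thesis using nonzero [of "k + 4"] by simp
qed

lemma period_shift:
  assumes "c \<le> 3"
  shows "z (k + period c) = z k"
proof -
  from assms c_pos consider "c = 1" | "c = 2" | "c = 3" by linarith
  then show ?thesis
    by cases (simp_all add: period_def period_5 period_6 period_8)
qed

lemma period_cong:
  assumes "c \<le> 3" and "k mod period c = l mod period c"
  shows "z k = z l"
proof -
  have mult: "z (k + int n * period c) = z k" for k n
  proof (induction n)
    case (Suc n)
    have "z (k + int (Suc n) * period c) = z ((k + int n * period c) + period c)"
      by (simp add: algebra_simps)
    then show ?case using Suc period_shift [OF assms(1)] by simp
  qed simp
  have "z k = z (k mod period c)" for k
  proof (cases "k div period c \<ge> 0")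
    case True
    then show ?thesis
      using mult [of "k mod period c" "nat (k div period c)"] by simp
  next
    case False
    then have "k mod period c = k + int (nat (- (k div period c))) * period c"
      by (simp add: minus_div_mult_eq_mod [symmetric])
    then show ?thesis
      by (simp only: mult)
  qed
  from this [of k] this [of l] assms(2) show ?thesis by simp
qed

end

section \<open>Additive closures, subrings and integer spans\<close>

text \<open>
  The sums of one or more elements of \<open>S\<close>. Applied to Laurent monomials this gives the Laurent
  polynomials with positive coefficients, and applied to a basis the positive combinations.
\<close>

inductive_set additive_closure :: "'a::plus set \<Rightarrow> 'a set" for S where
  base: "x \<in> S \<Longrightarrow> x \<in> additive_closure S"
| add: "x \<in> additive_closure S \<Longrightarrow> y \<in> additive_closure S \<Longrightarrow> x + y \<in> additive_closure S"

lemma additive_closure_mono: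
  assumes "x \<in> additive_closure S" and "S \<subseteq> T"
  shows "x \<in> additive_closure T"
  using assms(1) by induction (use assms(2) in \<open>auto intro: additive_closure.intros\<close>)

lemma additive_closure_mult:
  fixes x y :: "'a::semiring"
  assumes "x \<in> additive_closure S" and "y \<in> additive_closure T"
    and "\<And>s t. s \<in> S \<Longrightarrow> t \<in> T \<Longrightarrow> s * t \<in> U"
  shows "x * y \<in> additive_closure U"
  using assms(1)
proof induction
  case (base x)
  from assms(2) show ?case
    by induction (use base assms(3) in \<open>auto intro: additive_closure.intros simp: distrib_left\<close>)
qed (auto intro: additive_closure.intros simp: distrib_right)

lemma subring_generated_zero: "0 \<in> subring_generated S"
  using subring_generated.diff [OF subring_generated.one subring_generated.one, of S] by simp

lemma subring_generated_uminus: "x \<in> subring_generated S \<Longrightarrow> - x \<in> subring_generated S"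
  using subring_generated.diff [OF subring_generated_zero, of x S] by simp

lemma subring_generated_add:
  "x \<in> subring_generated S \<Longrightarrow> y \<in> subring_generated S \<Longrightarrow> x + y \<in> subring_generated S"
  using subring_generated.diff [of x S "- y"] subring_generated_uminus [of y S] by simp

lemma subring_generated_power: "x \<in> subring_generated S \<Longrightarrow> x ^ n \<in> subring_generated S"
  by (induction n) (auto intro: subring_generated.intros)

lemma subring_generated_of_int: "of_int n \<in> subring_generated S"
proof -
  have "of_nat k \<in> subring_generated S" for k
    by (induction k) (auto intro: subring_generated_zero subring_generated_add subring_generated.one)
  then show ?thesis
    by (cases n) (auto intro: subring_generated_uminus simp del: of_nat_Suc)
qed

lemma int_span_subset_subring_generated:
  fixes S :: "'a::comm_ring_1 set"
  assumes "T \<subseteq> subring_generated S"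
  shows "int_mod.span T \<subseteq> subring_generated S"
proof (rule int_mod.span_minimal [OF assms], rule int_mod.subspaceI)
qed (auto intro: subring_generated_zero subring_generated_add subring_generated.mult subring_generated_of_int)

lemma int_span_mult:
  fixes x y :: "'a::comm_ring_1"
  assumes "x \<in> int_mod.span S" and "y \<in> int_mod.span S"
    and "\<And>s t. s \<in> S \<Longrightarrow> t \<in> S \<Longrightarrow> s * t \<in> S"
  shows "x * y \<in> int_mod.span S"
  using assms(1)
proof (induction rule: int_mod.span_induct_alt)
  case base
  then show ?case by (simp add: int_mod.span_zero)
next
  case (step n s x)
  have "s * y \<in> int_mod.span S"
    using assms(2)
  proof (induction rule: int_mod.span_induct_alt)
    case base
    then show ?case by (simp add: int_mod.span_zero)
  next
    case (step m t y)
    have "of_int m * (s * t) + s * y \<in> int_mod.span S"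
      using step \<open>s \<in> S\<close> assms(3)
      by (intro int_mod.span_add int_mod.span_scale) (auto intro: int_mod.span_base)
    then show ?case by (simp add: algebra_simps)
  qed
  then have "of_int n * (s * y) + x * y \<in> int_mod.span S"
    using step by (intro int_mod.span_add int_mod.span_scale)
  then show ?case by (simp add: algebra_simps)
qed

section \<open>Straightening: cluster monomials span the cluster algebra\<close>

lemma prod_mset_two_values:
  fixes f :: "'b \<Rightarrow> 'a::comm_monoid_mult"
  assumes "\<forall>k\<in>#M. f k = a \<or> f k = b"
  shows "\<exists>p q. (\<Prod>k\<in>#M. f k) = a ^ p * b ^ q"
  using assms
proof (induction M)
  case empty
  show ?case by (rule exI [of _ 0], rule exI [of _ 0]) simp
next
  case (add k M)
  then obtain p q where "(\<Prod>k\<in>#M. f k) = a ^ p * b ^ q" by auto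
  with add.prems have "(\<Prod>k\<in>#add_mset k M. f k) = a ^ Suc p * b ^ q \<or>
      (\<Prod>k\<in>#add_mset k M. f k) = a ^ p * b ^ Suc q"
    by (auto simp: mult.assoc mult.left_commute)
  then show ?case by blast
qed

definition adjacent_monomials :: "(int \<Rightarrow> 'a::comm_monoid_mult) \<Rightarrow> 'a set" where
  "adjacent_monomials z = {z m ^ p * z (m + 1) ^ q | m p q. True}"

context exchange_sequence
begin

text \<open>
  The weights are chosen such that every product formula lowers the weight: with \<open>w\<close> and \<open>w'\<close>
  for even and odd indices, the exchange relations require \<open>w < 2 * w'\<close> and \<open>c * w' < 2 * w\<close>.
  For \<open>c \<ge> 4\<close> these requirements contradict each other.
\<close>

definition weight :: "int \<Rightarrow> nat" where
  "weight k = (if even k then 2 * c - 1 else c)"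

definition lighter :: "nat \<Rightarrow> 'a set" where
  "lighter n = additive_closure {(\<Prod>k\<in>#M. z k) | M. (\<Sum>k\<in>#M. weight k) < n}"

lemma lighter_product: "(\<Sum>k\<in>#M. weight k) < n \<Longrightarrow> (\<Prod>k\<in>#M. z k) \<in> lighter n"
  unfolding lighter_def by (rule additive_closure.base) auto

lemma lighter_var: "weight k < n \<Longrightarrow> z k \<in> lighter n"
  using lighter_product [of "{#k#}" n] by simp

lemma lighter_power: "e * weight k < n \<Longrightarrow> z k ^ e \<in> lighter n"
  using lighter_product [of "replicate_mset e k" n] by simp

lemma lighter_one: "0 < n \<Longrightarrow> 1 \<in> lighter n"
  using lighter_product [of "{#}" n] by simp

lemma lighter_add: "x \<in> lighter n \<Longrightarrow> y \<in> lighter n \<Longrightarrow> x + y \<in> lighter n"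
  unfolding lighter_def by (rule additive_closure.add)

lemma lighter_three: "0 < n \<Longrightarrow> 3 \<in> lighter n"
  using lighter_add [OF lighter_add [OF lighter_one lighter_one] lighter_one, of n] by simp

lemma weight_cong:
  assumes "c \<le> 3" and "k mod period c = l mod period c"
  shows "weight k = weight l"
proof (cases "c = 1")
  case False
  then have "even (period c)"
    by (simp add: period_def)
  then have "even k = even l"
    using assms(2) by (metis dvd_mod_iff)
  then show ?thesis
    by (simp add: weight_def)
next
  case True
  then show ?thesis
    unfolding weight_def by simp
qed

lemma straighten_2:
  assumes "c \<le> 3"
  shows "z k * z (k + 2) \<in> lighter (weight k + weight (k + 2))"
proof (cases "even k")
  case True
  have "c * c < 4 * c - 2"
    using assms c_pos by (cases "c = 1 \<or> c = 2 \<or> c = 3") auto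
  with True show ?thesis
    using odd_exchange [of "k + 1"] c_pos
    by (auto simp: algebra_simps weight_def intro!: lighter_add lighter_power lighter_one)
next
  case False
  then show ?thesis
    using even_exchange [of "k + 1"] c_pos
    by (auto simp: algebra_simps weight_def intro!: lighter_add lighter_var lighter_one)
qed

lemma straighten_3:
  assumes "c \<le> 3"
  shows "z k * z (k + 3) \<in> lighter (weight k + weight (k + 3))"
proof -
  have *: "(c - 1) * c < (2 * c - 1) + c" "c < (2 * c - 1) + c"
    using assms c_pos by (cases "c = 1 \<or> c = 2 \<or> c = 3"; auto)+
  show ?thesis
  proof (cases "even k")
    case True
    then have "z k * z (k + 3) = z (k + 1) ^ (c - 1) + z (k - 1)"
      using product_frame_3 [of k 1] by simp
    with True * show ?thesis
      by (auto simp: weight_def intro!: lighter_add lighter_power lighter_var)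
  next
    case False
    then have "z k * z (k + 3) = z (k + 2) ^ (c - 1) + z (k + 4)"
      using product_frame_3 [of "k + 3" "- 1"] by (simp add: algebra_simps)
    with False * show ?thesis
      by (auto simp: weight_def intro!: lighter_add lighter_power lighter_var)
  qed
qed

lemma straighten_4:
  assumes "c = 3"
  shows "z k * z (k + 4) \<in> lighter (weight k + weight (k + 4))"
proof -
  have w: "weight j = (if even j then 5 else 3)" for j
    unfolding weight_def using assms by simp
  show ?thesis
  proof (cases "even k")
    case True
    then have "z k * z (k + 4) = z (k + 2) + z (k - 2) + 3"
      using product_frame_0_4 [of k 1] assms by simp
    with True show ?thesis
      by (auto simp: w intro!: lighter_add lighter_var lighter_three)
  next
    case False
    then have "z k * z (k + 4) = z (k + 2) + z (k - 2)"
      using product_frame_1_5 [of "k - 1" 1] assms by (simp add: algebra_simps)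
    with False show ?thesis
      by (auto simp: w intro!: lighter_add lighter_var)
  qed
qed

text \<open>
  Adjacency in the cyclic order of the cluster variables, that is, membership in a common cluster.
\<close>

definition compatible :: "int \<Rightarrow> int \<Rightarrow> bool" where
  "compatible k l \<longleftrightarrow> (l - k) mod period c \<in> {0, 1, period c - 1}"

text \<open>
  By periodicity the distance of two incompatible indices is between \<open>2\<close> and the period minus
  \<open>2\<close>. Going around the circle the other way replaces a distance by its complement, so that the
  product formulas at distance \<open>2\<close>, \<open>3\<close> and (in type \<open>G\<^sub>2\<close>) \<open>4\<close> cover everything.
\<close>

lemma straighten:
  assumes "c \<le> 3" and "\<not> compatible k l"
  shows "z k * z l \<in> lighter (weight k + weight l)"
proof -
  define d where "d = (l - k) mod period c"
  have "(k + d) mod period c = l mod period c"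
    unfolding d_def by (simp add: mod_simps)
  then have l: "z l = z (k + d)" "weight l = weight (k + d)"
    using period_cong [OF assms(1)] weight_cong [OF assms(1)] by metis+
  have pc: "period c > 0" by (simp add: period_def)
  have wrap: "z k * z (k + d) \<in> lighter (weight k + weight (k + d))"
    if "z (k + d) * z (k + d + e) \<in> lighter (weight (k + d) + weight (k + d + e))"
      and "d + e = period c" for e
  proof -
    have "(k + d + e) mod period c = k mod period c"
      using that(2) by (simp add: add.assoc)
    then have "z (k + d + e) = z k" "weight (k + d + e) = weight k"
      using period_cong [OF assms(1)] weight_cong [OF assms(1)] by metis+
    then show ?thesis
      using that(1) by (simp add: ac_simps)
  qed
  have "0 \<le> d" "d < period c" "d \<noteq> 0" "d \<noteq> 1" "d \<noteq> period c - 1"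
    using assms(2) pc by (auto simp: d_def compatible_def)
  then have range: "2 \<le> d" "d \<le> period c - 2" by auto
  from assms(1) c_pos consider "c = 1" | "c = 2" | "c = 3" by linarith
  then have "z k * z (k + d) \<in> lighter (weight k + weight (k + d))"
  proof cases
    case 1
    with range consider "d = 2" | "d = 3" by (force simp: period_def)
    then show ?thesis
      by cases (use straighten_2 [OF assms(1)] straighten_3 [OF assms(1)] in auto)
  next
    case 2
    with range consider "d = 2" | "d = 3" | "d = 4" by (force simp: period_def)
    then show ?thesis
    proof cases
      case 3
      then show ?thesis
        using wrap [OF straighten_2 [OF assms(1)]] 2 by (simp add: period_def)
    qed (use straighten_2 [OF assms(1)] straighten_3 [OF assms(1)] in auto)
  next
    case 3
    with range consider "d = 2" | "d = 3" | "d = 4" | "d = 5" | "d = 6"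
      by (force simp: period_def)
    then show ?thesis
    proof cases
      case 4
      then show ?thesis
        using wrap [OF straighten_3 [OF assms(1)]] 3 by (simp add: period_def)
    next
      case 5
      then show ?thesis
        using wrap [OF straighten_2 [OF assms(1)]] 3 by (simp add: period_def)
    qed (use straighten_2 [OF assms(1)] straighten_3 [OF assms(1)] straighten_4 [OF 3] in auto)
  qed
  then show ?thesis by (simp add: l)
qed

text \<open>
  A cycle of length at least \<open>5\<close> contains no triangle, so pairwise adjacent vertices lie on one
  edge.
\<close>

lemma compatible_imp_adjacent:
  assumes "c \<le> 3" and "\<And>k l. k \<in># M \<Longrightarrow> l \<in># M \<Longrightarrow> compatible k l"
  shows "\<exists>m. \<forall>k\<in>#M. z k = z m \<or> z k = z (m + 1)"
proof -
  have residues: "(k - m) mod period c \<in> {0, 1}"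
    if "compatible m k" "compatible (m + 1) k" for k m
  proof -
    define r where "r = (k - m) mod period c"
    have "(k - (m + 1)) mod period c = (r - 1) mod period c"
      by (simp add: r_def mod_simps algebra_simps)
    with that have "r \<in> {0, 1, period c - 1}" "(r - 1) mod period c \<in> {0, 1, period c - 1}"
      by (simp_all add: compatible_def r_def)
    then have "r \<in> {0, 1}"
      by (auto simp: period_def split: if_splits)
    then show ?thesis by (simp add: r_def)
  qed
  have adj: "z k = z m \<or> z k = z (m + 1)" if "(k - m) mod period c \<in> {0, 1}" for k m
  proof -
    have "(m + (k - m) mod period c) mod period c = k mod period c"
      by (simp add: mod_simps)
    then have "z k = z (m + (k - m) mod period c)"
      using period_cong [OF assms(1)] by metis
    with that show ?thesis by auto
  qed
  have cong: "compatible m' k" if "compatible m k" "m mod period c = m' mod period c" for m m' k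
    using that unfolding compatible_def by (metis mod_diff_right_eq)
  consider "M = {#}" | m where "m \<in># M" "\<forall>k\<in>#M. (k - m) mod period c = 0"
    | m l where "m \<in># M" "l \<in># M" "(l - m) mod period c = 1"
    | m l where "m \<in># M" "l \<in># M" "(l - m) mod period c = period c - 1"
    using assms(2) unfolding compatible_def by (metis insertE multiset_nonemptyE singletonD)
  then show ?thesis
  proof cases
    case 1
    then show ?thesis by simp
  next
    case 2
    then show ?thesis using adj by blast
  next
    case 3
    have "l mod period c = (m + (l - m) mod period c) mod period c"
      by (simp add: mod_simps)
    with 3 have "l mod period c = (m + 1) mod period c" by simp
    with 3 residues adj assms(2) cong show ?thesis by metis
  next
    case 4
    have "m mod period c = (l - (l - m) mod period c) mod period c"
      by (simp add: mod_simps)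
    also have "\<dots> = (l + 1 - period c) mod period c"
      unfolding 4(3) by (simp add: algebra_simps)
    finally have "m mod period c = (l + 1) mod period c" by simp
    with 4 residues adj assms(2) cong show ?thesis by metis
  qed
qed

text \<open>
  Induction on the weight: a product that contains an incompatible pair is straightened into products
  of smaller weight, and any other product is itself a cluster monomial.
\<close>

lemma product_in_span:
  assumes "c \<le> 3"
  shows "(\<Prod>k\<in>#M. z k) \<in> int_mod.span (adjacent_monomials z)"
proof (induction "\<Sum>k\<in>#M. weight k" arbitrary: M rule: less_induct)
  case less
  show ?case
  proof (cases "\<exists>k l. k \<in># M \<and> l \<in># M \<and> \<not> compatible k l")
    case True
    then obtain k l where kl: "k \<in># M" "l \<in># M" "\<not> compatible k l" by blast
    then have "k \<noteq> l" by (auto simp: compatible_def)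
    with kl obtain N where M: "M = {#k, l#} + N"
      by (metis add_mset_add_single insert_noteq_member mset_add union_mset_add_mset_left
          add_mset_commute add_cancel_left_left empty_neutral(1))
    have "x * (\<Prod>k\<in>#N. z k) \<in> int_mod.span (adjacent_monomials z)"
      if "x \<in> lighter (weight k + weight l)" for x
      using that unfolding lighter_def
    proof induction
      case (base x)
      then obtain N' where N': "x = (\<Prod>k\<in>#N'. z k)" "(\<Sum>k\<in>#N'. weight k) < weight k + weight l"
        by auto
      then show ?case
        using less [of "N' + N"] M by simp
    next
      case (add x y)
      then show ?case by (simp add: distrib_right int_mod.span_add)
    qed
    from this [OF straighten [OF assms kl(3)]] show ?thesis
      by (simp add: M mult.assoc)
  next
    case False
    then obtain m where "\<forall>k\<in>#M. z k = z m \<or> z k = z (m + 1)"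
      using compatible_imp_adjacent [OF assms, of M] by blast
    then obtain p q where "(\<Prod>k\<in>#M. z k) = z m ^ p * z (m + 1) ^ q"
      using prod_mset_two_values by blast
    then show ?thesis
      by (auto intro!: int_mod.span_base simp: adjacent_monomials_def)
  qed
qed

lemma subring_generated_eq_span:
  assumes "c \<le> 3"
  shows "subring_generated (range z) = int_mod.span (adjacent_monomials z)"
proof
  let ?P = "range (\<lambda>M. \<Prod>k\<in>#M. z k)"
  have mult: "x * y \<in> ?P" if "x \<in> ?P" "y \<in> ?P" for x y
  proof -
    from that obtain M N where "x = (\<Prod>k\<in>#M. z k)" "y = (\<Prod>k\<in>#N. z k)" by auto
    then have "x * y = (\<Prod>k\<in>#M + N. z k)" by simp
    then show ?thesis by blast
  qed
  have "x \<in> int_mod.span ?P" if "x \<in> subring_generated (range z)" for x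
    using that
  proof induction
    case (gen x)
    then obtain k where "x = (\<Prod>k\<in>#{#k#}. z k)" by auto
    then show ?case by (intro int_mod.span_base) blast
  next
    case one
    have "1 = (\<Prod>k\<in>#{#}. z k)" by simp
    then show ?case by (intro int_mod.span_base) blast
  next
    case (mult x y)
    then show ?case by (intro int_span_mult \<open>\<And>y x. x \<in> ?P \<Longrightarrow> y \<in> ?P \<Longrightarrow> x * y \<in> ?P\<close>)
  qed (rule int_mod.span_diff)
  moreover have "int_mod.span ?P \<subseteq> int_mod.span (adjacent_monomials z)"
    using product_in_span [OF assms] by (intro int_mod.span_minimal int_mod.subspace_span) auto
  ultimately show "subring_generated (range z) \<subseteq> int_mod.span (adjacent_monomials z)" by blast
  show "int_mod.span (adjacent_monomials z) \<subseteq> subring_generated (range z)"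
    by (rule int_span_subset_subring_generated)
      (auto simp: adjacent_monomials_def
        intro!: subring_generated.mult subring_generated_power intro: subring_generated.gen)
qed

end

section \<open>Laurent expansions of cluster monomials\<close>

definition laurent_monomials :: "'a::field \<Rightarrow> 'a \<Rightarrow> (int \<times> int) set \<Rightarrow> 'a set" where
  "laurent_monomials u v S = (\<lambda>(i, j). u powi i * v powi j) ` S"

text \<open>
  The exponent vectors of the monomials that are not polynomial in the two variables of the cluster.
\<close>

definition proper_exponents :: "(int \<times> int) set" where
  "proper_exponents = {(i, j). i < 0 \<or> j < 0}"

lemma laurent_monomials_swap:
  "laurent_monomials u v proper_exponents = laurent_monomials v u proper_exponents"
  by (force simp: laurent_monomials_def proper_exponents_def image_iff mult.commute)

context exchange_sequence
begin

text \<open>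
  Positive Laurent polynomials in \<open>z 0\<close> and \<open>z 1\<close> on whose exponent vectors \<open>(i, j)\<close> the
  linear form \<open>a * i + b * j\<close> is at most \<open>n\<close>. The bounds below behave like tropical
  polynomials: products add, sums take maxima.
\<close>

definition degree_le :: "int \<Rightarrow> int \<Rightarrow> int \<Rightarrow> 'a set" where
  "degree_le a b n =
    additive_closure (laurent_monomials (z 0) (z 1) {(i, j). a * i + b * j \<le> n})"

lemma degree_le_monomial: "a * i + b * j \<le> n \<Longrightarrow> z 0 powi i * z 1 powi j \<in> degree_le a b n"
  unfolding degree_le_def laurent_monomials_def by (rule additive_closure.base) auto

lemma degree_le_mono: "x \<in> degree_le a b n \<Longrightarrow> n \<le> n' \<Longrightarrow> x \<in> degree_le a b n'"
  unfolding degree_le_def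
  by (erule additive_closure_mono) (auto simp: laurent_monomials_def)

lemma degree_le_mult:
  assumes "x \<in> degree_le a b n" and "y \<in> degree_le a b n'"
  shows "x * y \<in> degree_le a b (n + n')"
  using assms unfolding degree_le_def
proof (rule additive_closure_mult)
  fix s t
  assume "s \<in> laurent_monomials (z 0) (z 1) {(i, j). a * i + b * j \<le> n}"
    and "t \<in> laurent_monomials (z 0) (z 1) {(i, j). a * i + b * j \<le> n'}"
  then obtain i j i' j' where "s = z 0 powi i * z 1 powi j" "t = z 0 powi i' * z 1 powi j'"
    and le: "a * i + b * j \<le> n" "a * i' + b * j' \<le> n'"
    by (auto simp: laurent_monomials_def)
  then have "s * t = z 0 powi (i + i') * z 1 powi (j + j')"
    by (simp add: power_int_add nonzero ac_simps)
  moreover have "a * (i + i') + b * (j + j') \<le> n + n'"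
    using le by (simp add: algebra_simps)
  ultimately show "s * t \<in> laurent_monomials (z 0) (z 1) {(i, j). a * i + b * j \<le> n + n'}"
    by (auto simp: laurent_monomials_def)
qed

lemma degree_le_one: "1 \<in> degree_le a b 0"
  using degree_le_monomial [of a 0 b 0 0] by simp

lemma degree_le_power: "x \<in> degree_le a b n \<Longrightarrow> x ^ e \<in> degree_le a b (int e * n)"
  by (induction e) (auto simp: degree_le_one distrib_right intro: degree_le_mult)

lemma degree_le_add:
  assumes "x \<in> degree_le a b n" and "y \<in> degree_le a b n'"
  shows "x + y \<in> degree_le a b (max n n')"
  using degree_le_mono [OF assms(1), of "max n n'"] degree_le_mono [OF assms(2), of "max n n'"]
  unfolding degree_le_def by (simp add: additive_closure.add)

lemma degree_le_three: "3 \<in> degree_le a b 0"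
  using degree_le_add [OF degree_le_add [OF degree_le_one degree_le_one] degree_le_one, of a b]
  by simp

lemma degree_le_divide_0:
  assumes "z 0 * y = x" and "x \<in> degree_le a b n"
  shows "y \<in> degree_le a b (n - a)"
proof -
  have "y = (z 0 powi (- 1) * z 1 powi 0) * x"
    using assms(1) nonzero [of 0] by (auto simp: power_int_minus)
  with degree_le_mult [OF degree_le_monomial [of a "- 1" b 0 "- a"] assms(2)] show ?thesis
    by simp
qed

lemma degree_le_divide_1:
  assumes "z 1 * y = x" and "x \<in> degree_le a b n"
  shows "y \<in> degree_le a b (n - b)"
proof -
  have "y = (z 0 powi 0 * z 1 powi (- 1)) * x"
    using assms(1) nonzero [of 1] by (auto simp: power_int_minus)
  with degree_le_mult [OF degree_le_monomial [of a 0 b "- 1" "- b"] assms(2)] show ?thesis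
    by simp
qed

lemma degree_0: "z 0 \<in> degree_le a b a"
  using degree_le_monomial [of a 1 b 0 a] by simp

lemma degree_1: "z 1 \<in> degree_le a b b"
  using degree_le_monomial [of a 0 b 1 b] by simp

text \<open>
  Each of the following bounds comes from a formula that expresses the variable as a polynomial in
  earlier ones with positive coefficients, divided by \<open>z 0\<close> or by \<open>z 1\<close>. In particular each
  variable has a positive Laurent expansion.
\<close>

lemma degree_minus_1: "z (- 1) \<in> degree_le a b (max a 0 - b)"
  using even_exchange [of 0]
  by (intro degree_le_divide_1 [OF _ degree_le_add [OF degree_0 degree_le_one]])
    (simp add: mult.commute)

lemma degree_2: "z 2 \<in> degree_le a b (max (int c * b) 0 - a)"
  using odd_exchange [of 1]
  by (intro degree_le_divide_0 [OF _ degree_le_add [OF degree_le_power [OF degree_1] degree_le_one]])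
    simp

lemma degree_minus_2: "z (- 2) \<in> degree_le a b (max (int c * (max a 0 - b)) 0 - a)"
  using odd_exchange [of "- 1"]
  by (intro degree_le_divide_0
      [OF _ degree_le_add [OF degree_le_power [OF degree_minus_1] degree_le_one]])
    (simp add: mult.commute)

lemma degree_3: "z 3 \<in> degree_le a b (max (int (c - 1) * b) (max a 0 - b) - a)"
  by (intro degree_le_divide_0
      [OF product_0_3 degree_le_add [OF degree_le_power [OF degree_1] degree_minus_1]])

lemma degree_4:
  assumes "c = 3"
  shows "z 4 \<in> degree_le a b
    (max (max (max (int c * b) 0 - a) (max (int c * (max a 0 - b)) 0 - a)) 0 - a)"
  by (intro degree_le_divide_0
      [OF product_0_4 [OF assms] degree_le_add [OF degree_le_add [OF degree_2 degree_minus_2] degree_le_three]])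

lemma degree_5:
  assumes "c = 3"
  shows "z 5 \<in> degree_le a b
    (max (max (int (c - 1) * b) (max a 0 - b) - a) (max a 0 - b) - b)"
  by (intro degree_le_divide_1
      [OF product_1_5 [OF assms] degree_le_add [OF degree_3 degree_minus_1]])

definition initial_or_proper :: "'a \<Rightarrow> bool" where
  "initial_or_proper w \<longleftrightarrow> (\<exists>p q. w = z 0 ^ p * z 1 ^ q) \<or>
    w \<in> additive_closure (laurent_monomials (z 0) (z 1) proper_exponents)"

lemma proper_of_negative_degree:
  assumes "0 \<le> a" "0 \<le> b" and "x \<in> degree_le a b n" and "n < 0"
  shows "x \<in> additive_closure (laurent_monomials (z 0) (z 1) proper_exponents)"
proof -
  have "(i, j) \<in> proper_exponents" if "a * i + b * j \<le> n" for i j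
  proof (rule ccontr)
    assume "(i, j) \<notin> proper_exponents"
    then have "0 \<le> a * i + b * j"
      using assms(1,2) by (simp add: proper_exponents_def)
    with that assms(4) show False by simp
  qed
  then have "laurent_monomials (z 0) (z 1) {(i, j). a * i + b * j \<le> n}
      \<subseteq> laurent_monomials (z 0) (z 1) proper_exponents"
    by (auto simp: laurent_monomials_def)
  with assms(3) show ?thesis
    unfolding degree_le_def by (rule additive_closure_mono)
qed

lemma initial_or_proper_of_degree:
  assumes "0 \<le> a" "0 \<le> b"
    and "x \<in> degree_le a b n" "y \<in> degree_le a b n'" "n < 0" "n' < 0"
  shows "initial_or_proper (x ^ p * y ^ q)"
proof (cases "p = 0 \<and> q = 0")
  case True
  then have "x ^ p * y ^ q = z 0 ^ 0 * z 1 ^ 0" by simp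
  then show ?thesis unfolding initial_or_proper_def by blast
next
  case False
  then have "int p * n + int q * n' < 0"
    using assms(5,6) by (cases "p = 0"; cases "q = 0")
      (auto simp: mult_pos_neg intro!: add_neg_neg)
  then show ?thesis
    using proper_of_negative_degree [OF assms(1,2)
        degree_le_mult [OF degree_le_power [OF assms(3)] degree_le_power [OF assms(4)]]]
    unfolding initial_or_proper_def by blast
qed

lemma initial_or_proper_0_1: "initial_or_proper (z 0 ^ p * z 1 ^ q)"
  unfolding initial_or_proper_def by blast

text \<open>
  For the two clusters that share a variable with the initial one, no linear form with nonnegative
  coefficients is negative on both variables; the form that vanishes on the shared variable does the
  job.
\<close>

lemma initial_or_proper_1_2: "initial_or_proper (z 1 ^ p * z 2 ^ q)"
proof (cases "q = 0")
  case True
  then show ?thesis using initial_or_proper_0_1 [of 0 p] by simp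
next
  case False
  have "z 1 ^ p * z 2 ^ q \<in> degree_le 1 0 (int p * 0 + int q * - 1)"
    using degree_2 [of 1 0] by (intro degree_le_mult degree_le_power degree_1) simp
  with False show ?thesis
    using proper_of_negative_degree [of 1 0] unfolding initial_or_proper_def by simp
qed

lemma initial_or_proper_minus_1_0: "initial_or_proper (z (- 1) ^ p * z 0 ^ q)"
proof (cases "p = 0")
  case True
  then show ?thesis using initial_or_proper_0_1 [of q 0] by simp
next
  case False
  have "z (- 1) ^ p * z 0 ^ q \<in> degree_le 0 1 (int p * - 1 + int q * 0)"
    using degree_minus_1 [of 0 1] by (intro degree_le_mult degree_le_power degree_0) simp
  with False show ?thesis
    using proper_of_negative_degree [of 0 1] unfolding initial_or_proper_def by simp
qed

text \<open>
  One linear form \<open>(a, b)\<close> for each cluster disjoint from the initial one. The forms are found by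
  solving the linear inequalities that make both degree bounds negative; in each type the slope
  \<open>b / a\<close> increases along the cyclic order of the clusters.
\<close>

lemma adjacent_initial_or_proper:
  assumes "c \<le> 3"
  shows "initial_or_proper (z j ^ p * z (j + 1) ^ q)"
proof -
  note period = period_cong [OF assms]
  define r where "r = j mod period c"
  have zj: "z j = z r" "z (j + 1) = z (r + 1)"
    by (rule period; simp add: r_def mod_simps)+
  have "0 \<le> r" "r < period c"
    by (simp_all add: r_def period_def)
  from assms c_pos consider "c = 1" | "c = 2" | "c = 3" by linarith
  then have "initial_or_proper (z r ^ p * z (r + 1) ^ q)"
  proof cases
    case 1
    then have periodic: "z 3 = z (- 2)" "z 4 = z (- 1)" "z 5 = z 0"
      by (auto intro!: period simp: period_def)
    have "initial_or_proper (z 2 ^ p * z (- 2) ^ q)"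
      using initial_or_proper_of_degree [OF _ _ degree_2 degree_minus_2, of 2 1] 1 by simp
    moreover have "initial_or_proper (z (- 2) ^ p * z (- 1) ^ q)"
      using initial_or_proper_of_degree [OF _ _ degree_minus_2 degree_minus_1, of 1 2] 1 by simp
    moreover have "r \<in> {0, 1, 2, 3, 4}"
      using \<open>0 \<le> r\<close> \<open>r < period c\<close> 1 by (auto simp: period_def)
    ultimately show ?thesis
      using initial_or_proper_0_1 initial_or_proper_1_2 initial_or_proper_minus_1_0 periodic
      by auto
  next
    case 2
    then have periodic: "z 4 = z (- 2)" "z 5 = z (- 1)" "z 6 = z 0"
      by (auto intro!: period simp: period_def)
    have "initial_or_proper (z 2 ^ p * z 3 ^ q)"
      using initial_or_proper_of_degree [OF _ _ degree_2 degree_3, of 3 1] 2 by simp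
    moreover have "initial_or_proper (z 3 ^ p * z (- 2) ^ q)"
      using initial_or_proper_of_degree [OF _ _ degree_3 degree_minus_2, of 3 2] 2 by simp
    moreover have "initial_or_proper (z (- 2) ^ p * z (- 1) ^ q)"
      using initial_or_proper_of_degree [OF _ _ degree_minus_2 degree_minus_1, of 1 2] 2 by simp
    moreover have "r \<in> {0, 1, 2, 3, 4, 5}"
      using \<open>0 \<le> r\<close> \<open>r < period c\<close> 2 by (auto simp: period_def)
    ultimately show ?thesis
      using initial_or_proper_0_1 initial_or_proper_1_2 initial_or_proper_minus_1_0 periodic
      by auto
  next
    case 3
    then have periodic: "z 6 = z (- 2)" "z 7 = z (- 1)" "z 8 = z 0"
      by (auto intro!: period simp: period_def)
    have "initial_or_proper (z 2 ^ p * z 3 ^ q)"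
      using initial_or_proper_of_degree [OF _ _ degree_2 degree_3, of 4 1] 3 by simp
    moreover have "initial_or_proper (z 3 ^ p * z 4 ^ q)"
      using initial_or_proper_of_degree [OF _ _ degree_3 degree_4 [OF 3], of 5 2] 3 by simp
    moreover have "initial_or_proper (z 4 ^ p * z 5 ^ q)"
      using initial_or_proper_of_degree [OF _ _ degree_4 [OF 3] degree_5 [OF 3], of 5 3] 3 by simp
    moreover have "initial_or_proper (z 5 ^ p * z (- 2) ^ q)"
      using initial_or_proper_of_degree [OF _ _ degree_5 [OF 3] degree_minus_2, of 4 3] 3 by simp
    moreover have "initial_or_proper (z (- 2) ^ p * z (- 1) ^ q)"
      using initial_or_proper_of_degree [OF _ _ degree_minus_2 degree_minus_1, of 1 2] 3 by simp
    moreover have "r \<in> {0, 1, 2, 3, 4, 5, 6, 7}"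
      using \<open>0 \<le> r\<close> \<open>r < period c\<close> 3 by (auto simp: period_def)
    ultimately show ?thesis
      using initial_or_proper_0_1 initial_or_proper_1_2 initial_or_proper_minus_1_0 periodic
      by auto
  qed
  then show ?thesis by (simp add: zj)
qed

text \<open>
  A cluster \<open>{m, m + 1}\<close> is moved to the initial position by a translation for even \<open>m\<close>; for
  odd \<open>m\<close> a reflection is needed, which interchanges the two variables.
\<close>

lemma adjacent_monomial_cases:
  assumes "c \<le> 3" and "w \<in> adjacent_monomials z"
  shows "(\<exists>p q. w = z m ^ p * z (m + 1) ^ q) \<or>
    w \<in> additive_closure (laurent_monomials (z m) (z (m + 1)) proper_exponents)"
proof -
  from assms(2) obtain k p q where w: "w = z k ^ p * z (k + 1) ^ q"
    by (auto simp: adjacent_monomials_def)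
  show ?thesis
  proof (cases "even m")
    case True
    interpret f: exchange_sequence "\<lambda>j. z (m + 1 * j)" c
      using True by (intro frame) simp_all
    have "f.initial_or_proper w"
      using f.adjacent_initial_or_proper [OF assms(1), of "k - m" p q] by (simp add: w add.commute)
    then show ?thesis
      unfolding f.initial_or_proper_def by simp
  next
    case False
    interpret f: exchange_sequence "\<lambda>j. z ((m + 1) + - 1 * j)" c
      using False by (intro frame) simp_all
    have "f.initial_or_proper w"
      using f.adjacent_initial_or_proper [OF assms(1), of "m - k" q p]
      by (simp add: w algebra_simps)
    then show ?thesis
      unfolding f.initial_or_proper_def
      by (auto simp: laurent_monomials_swap [of "z (m + 1)"] mult.commute)
  qed
qed

end

section \<open>Algebraic independence of adjacent cluster variables\<close>

text \<open>
  Algebraic independence over the integers, phrased with coefficient arrays on a square because this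
  form is visibly symmetric in \<open>u\<close> and \<open>v\<close>.
\<close>

definition independent_pair :: "'a::field \<Rightarrow> 'a \<Rightarrow> bool" where
  "independent_pair u v \<longleftrightarrow> (\<forall>(F :: nat \<Rightarrow> nat \<Rightarrow> int) N.
    (\<Sum>i<N. \<Sum>j<N. of_int (F i j) * u ^ i * v ^ j) = 0 \<longrightarrow> (\<forall>i<N. \<forall>j<N. F i j = 0))"

lemma independent_pairD:
  "independent_pair u v \<Longrightarrow> (\<Sum>i<N. \<Sum>j<N. of_int (F i j) * u ^ i * v ^ j) = 0
    \<Longrightarrow> i < N \<Longrightarrow> j < N \<Longrightarrow> F i j = 0"
  unfolding independent_pair_def by blast

lemma independent_pair_swap:
  assumes "independent_pair u v"
  shows "independent_pair v u"
  unfolding independent_pair_def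
proof (intro allI impI)
  fix F :: "nat \<Rightarrow> nat \<Rightarrow> int" and N i j
  assume "(\<Sum>i<N. \<Sum>j<N. of_int (F i j) * v ^ i * u ^ j) = 0" and ij: "i < N" "j < N"
  then have "(\<Sum>j<N. \<Sum>i<N. of_int (F i j) * u ^ j * v ^ i) = 0"
    by (subst sum.swap) (simp add: ac_simps)
  from independent_pairD [OF assms this ij(2,1)] show "F i j = 0" .
qed

abbreviation int_poly_eval :: "int poly \<Rightarrow> 'a::field \<Rightarrow> 'a" where
  "int_poly_eval P v \<equiv> poly (map_poly of_int P) v"

lemma map_poly_of_int_mult:
  "map_poly (of_int :: int \<Rightarrow> 'a::comm_ring_1) (P * Q) = map_poly of_int P * map_poly of_int Q"
  by (rule poly_eqI) (simp add: coeff_map_poly coeff_mult)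

lemma int_poly_eval_altdef:
  assumes "degree P < M"
  shows "int_poly_eval P v = (\<Sum>l<M. of_int (coeff P l) * (v :: 'a::field) ^ l)"
proof -
  have "int_poly_eval P v = (\<Sum>l\<le>degree (map_poly of_int P :: 'a poly). of_int (coeff P l) * v ^ l)"
    by (simp add: poly_altdef coeff_map_poly)
  also have "\<dots> = (\<Sum>l<M. of_int (coeff P l) * v ^ l)"
  proof (rule sum.mono_neutral_left)
    show "{..degree (map_poly of_int P :: 'a poly)} \<subseteq> {..<M}"
    proof -
      have "degree (map_poly of_int P :: 'a poly) \<le> degree P"
        by (rule degree_le) (simp add: coeff_map_poly coeff_eq_0)
      with assms show ?thesis by auto
    qed
    show "\<forall>i\<in>{..<M} - {..degree (map_poly of_int P :: 'a poly)}. of_int (coeff P i) * v ^ i = 0"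
    proof
      fix i
      assume "i \<in> {..<M} - {..degree (map_poly of_int P :: 'a poly)}"
      then have "coeff (map_poly of_int P :: 'a poly) i = 0"
        by (intro coeff_eq_0) auto
      then show "of_int (coeff P i) * v ^ i = 0"
        by (simp add: coeff_map_poly)
    qed
  qed simp
  finally show ?thesis .
qed

text \<open>
  Algebraic independence in its asymmetric form: \<open>u\<close> is transcendental over the ring generated by
  \<open>v\<close>.
\<close>

lemma independent_pair_poly:
  assumes "independent_pair u v" and "(\<Sum>k<N. u ^ k * int_poly_eval (P k) v) = 0" and "k < N"
  shows "P k = 0"
proof -
  define M where "M = Suc (max N (\<Sum>k<N. degree (P k)))"
  define F where "F i l = (if i < N then coeff (P i) l else 0)" for i l
  have deg: "degree (P i) < M" if "i < N" for i
    using that member_le_sum [of i "{..<N}" "\<lambda>k. degree (P k)"] by (simp add: M_def)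
  have "(\<Sum>i<M. \<Sum>j<M. of_int (F i j) * u ^ i * v ^ j) =
      (\<Sum>i<N. \<Sum>j<M. of_int (F i j) * u ^ i * v ^ j)"
    by (rule sum.mono_neutral_right) (auto simp: M_def F_def)
  also have "\<dots> = (\<Sum>k<N. u ^ k * int_poly_eval (P k) v)"
    by (intro sum.cong refl)
      (simp add: int_poly_eval_altdef [OF deg] sum_distrib_left F_def ac_simps)
  finally have zero: "(\<Sum>i<M. \<Sum>j<M. of_int (F i j) * u ^ i * v ^ j) = 0"
    using assms(2) by simp
  show ?thesis
  proof (rule poly_eqI)
    fix l
    show "coeff (P k) l = coeff 0 l"
    proof (cases "l < M")
      case True
      have "k < M" using assms(3) by (simp add: M_def)
      from independent_pairD [OF assms(1) zero this True] assms(3) show ?thesis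
        by (simp add: F_def)
    next
      case False
      then show ?thesis using deg [OF assms(3)] by (simp add: coeff_eq_0)
    qed
  qed
qed

text \<open>
  In a relation between \<open>v\<close> and \<open>w = (v ^ e + 1) / u\<close>, collect the powers of \<open>u\<close>. Since
  \<open>u\<close> is transcendental over the polynomials in \<open>v\<close>, the coefficient of each power vanishes;
  it is a power of \<open>v ^ e + 1\<close> times a coefficient polynomial of the given relation, so the latter
  vanishes as well.
\<close>

lemma independent_pair_mutation:
  fixes u v w :: "'a::field"
  assumes "independent_pair u v" and "u \<noteq> 0" "w \<noteq> 0" and "u * w = v ^ e + 1"
  shows "independent_pair v w"
  unfolding independent_pair_def
proof (intro allI impI)
  fix F :: "nat \<Rightarrow> nat \<Rightarrow> int" and N i j
  assume zero: "(\<Sum>i<N. \<Sum>j<N. of_int (F i j) * v ^ i * w ^ j) = 0" and ij: "i < N" "j < N"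
  define R :: "nat \<Rightarrow> int poly" where "R j = (\<Sum>i<N. monom (F i j) i)" for j
  define D :: "int poly" where "D = monom 1 e + 1"
  have D: "int_poly_eval D v = u * w"
  proof -
    have "(map_poly of_int D :: 'a poly) = monom 1 e + 1"
      by (rule poly_eqI) (simp add: D_def coeff_map_poly)
    then show ?thesis
      by (simp add: poly_monom assms(4))
  qed
  have R: "int_poly_eval (R j) v = (\<Sum>i<N. of_int (F i j) * v ^ i)" for j
  proof -
    have "(map_poly of_int (R j) :: 'a poly) = (\<Sum>i<N. monom (of_int (F i j)) i)"
      by (rule poly_eqI) (simp add: R_def coeff_map_poly coeff_sum)
    then show ?thesis
      by (simp add: poly_sum poly_monom)
  qed
  have D_power: "int_poly_eval (D ^ j * R j) v = (u * w) ^ j * (\<Sum>i<N. of_int (F i j) * v ^ i)" for j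
  proof -
    have "int_poly_eval (D ^ j) v = (u * w) ^ j"
      by (induction j) (simp_all add: map_poly_of_int_mult D)
    then show ?thesis
      by (simp add: map_poly_of_int_mult R)
  qed
  \<comment> \<open>The factor \<open>u ^ (N - 1)\<close> clears the powers of \<open>u\<close> in the denominators of
    \<open>w ^ j\<close>; the coefficient of \<open>w ^ j\<close> then goes with \<open>u ^ (N - 1 - j)\<close>.\<close>
  have "0 = u ^ (N - 1) * (\<Sum>i<N. \<Sum>j<N. of_int (F i j) * v ^ i * w ^ j)"
    using zero by simp
  also have "\<dots> = (\<Sum>j<N. u ^ (N - 1) * w ^ j * (\<Sum>i<N. of_int (F i j) * v ^ i))"
    by (subst sum.swap) (simp add: sum_distrib_left ac_simps)
  also have "\<dots> = (\<Sum>j<N. u ^ (N - Suc j) * int_poly_eval (D ^ j * R j) v)"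
  proof (rule sum.cong)
    fix j
    assume "j \<in> {..<N}"
    then have "u ^ (N - 1) = u ^ (N - Suc j) * u ^ j"
      by (simp flip: power_add)
    then show "u ^ (N - 1) * w ^ j * (\<Sum>i<N. of_int (F i j) * v ^ i) =
        u ^ (N - Suc j) * int_poly_eval (D ^ j * R j) v"
      unfolding D_power by (simp add: power_mult_distrib ac_simps)
  qed simp
  also have "\<dots> = (\<Sum>k<N. u ^ k * int_poly_eval (D ^ (N - Suc k) * R (N - Suc k)) v)"
    by (subst sum.nat_diff_reindex [symmetric]) (auto intro!: sum.cong)
  finally have "D ^ (N - Suc k) * R (N - Suc k) = 0" if "k < N" for k
    using independent_pair_poly
      [OF assms(1) _ that, where P = "\<lambda>k. D ^ (N - Suc k) * R (N - Suc k)"]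
    by metis
  from this [of "N - Suc j"] ij(2) have "D ^ j * R j = 0"
    by simp
  moreover have "D \<noteq> 0"
    using D assms(2,3) by auto
  ultimately have "coeff (R j) i = 0"
    by simp
  then show "F i j = 0"
    using ij(1) by (simp add: R_def coeff_sum if_distrib)
qed

lemma independent_pair_Y1_Y2: "independent_pair Y1 Y2"
  unfolding independent_pair_def
proof (intro allI impI)
  fix F :: "nat \<Rightarrow> nat \<Rightarrow> int" and N i j
  assume zero: "(\<Sum>i<N. \<Sum>j<N. of_int (F i j) * Y1 ^ i * Y2 ^ j) = 0" and ij: "i < N" "j < N"
  define p :: "rat poly poly" where
    "p = (\<Sum>i<N. \<Sum>j<N. of_int (F i j) * [:[:0, 1:]:] ^ i * [:0, 1:] ^ j)"
  have of_int: "to_fract (of_int k :: rat poly poly) = of_int k" for k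
  proof -
    have "to_fract (of_nat n :: rat poly poly) = of_nat n" for n
      by (induction n) simp_all
    then show ?thesis by (cases k) simp_all
  qed
  have power: "to_fract (q ^ n) = to_fract q ^ n" for q :: "rat poly poly" and n
    by (induction n) simp_all
  have sum: "to_fract (\<Sum>i<N. g i) = (\<Sum>i<N. to_fract (g i))" for g :: "nat \<Rightarrow> rat poly poly" and N
    by (induction N) simp_all
  have "to_fract p = 0"
    unfolding zero [symmetric] p_def Y1_def Y2_def to_fract_def [symmetric]
    by (simp add: sum power of_int)
  then have "p = 0" by simp
  have const_power: "[:[:0, 1:] :: rat poly:] ^ k = [:monom 1 k:]" for k
    by (induction k) (simp_all add: monom_altdef one_pCons)
  have "p = (\<Sum>i<N. \<Sum>j<N. monom (monom (of_int (F i j)) i) j)"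
    unfolding p_def
    by (intro sum.cong refl)
      (simp add: const_power monom_altdef of_int_poly smult_monom)
  then have "coeff (coeff p j) i = (\<Sum>i'<N. \<Sum>j'<N. if j' = j then if i' = i then of_int (F i' j') else 0 else 0)"
    by (simp add: coeff_sum) (intro sum.cong refl; simp)
  also have "\<dots> = of_int (F i j)"
    using ij by simp
  finally show "F i j = 0"
    using \<open>p = 0\<close> by simp
qed

lemma independent_adjacent_cluster_vars:
  "independent_pair (cluster_var b c m) (cluster_var b c (m + 1))"
proof (induction m rule: int_induct [where k = 1])
  case base
  show ?case
    using independent_pair_Y1_Y2 by (simp add: cluster_var.simps [of b c 1] cluster_var.simps [of b c 2])
next
  case (step1 m)
  then show ?case
    using independent_pair_mutation [OF _ cluster_var_nonzero cluster_var_nonzero]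
      cluster_var_exchange [of b c "m + 1"] by (simp add: algebra_simps)
next
  case (step2 m)
  have "independent_pair (cluster_var b c m) (cluster_var b c (m - 1))"
    using independent_pair_mutation [OF independent_pair_swap [OF step2(2)] cluster_var_nonzero cluster_var_nonzero]
      cluster_var_exchange [of b c m] by (simp add: mult.commute)
  then show ?case
    by (simp add: independent_pair_swap)
qed

section \<open>Uniqueness and positivity of Laurent expansions\<close>

lemma laurent_eval_superset:
  assumes "finite K" and "Poly_Mapping.keys f \<subseteq> K"
  shows "laurent_eval f u v =
    (\<Sum>k\<in>K. of_int (Poly_Mapping.lookup f k) * u powi fst k * v powi snd k)"
  unfolding laurent_eval_def case_prod_unfold prod.collapse
  using assms by (intro sum.mono_neutral_left) (auto simp: in_keys_iff)

lemma laurent_eval_add: "laurent_eval (f + g) u v = laurent_eval f u v + laurent_eval g u v"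
proof -
  let ?K = "Poly_Mapping.keys f \<union> Poly_Mapping.keys g"
  have "finite ?K" by simp
  note expand = laurent_eval_superset [OF this, of _ u v]
  show ?thesis
    unfolding expand [OF keys_add] expand [OF Un_upper1] expand [OF Un_upper2]
    by (simp add: lookup_add distrib_right sum.distrib)
qed

lemma laurent_eval_cmul: "laurent_eval (frag_cmul n f) u v = of_int n * laurent_eval f u v"
proof -
  have "laurent_eval (frag_cmul n f) u v = (\<Sum>k\<in>Poly_Mapping.keys f.
      of_int (Poly_Mapping.lookup (frag_cmul n f) k) * u powi fst k * v powi snd k)"
    by (rule laurent_eval_superset [OF finite_keys keys_cmul])
  also have "\<dots> = of_int n * (\<Sum>k\<in>Poly_Mapping.keys f.
      of_int (Poly_Mapping.lookup f k) * u powi fst k * v powi snd k)"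
    by (simp only: sum_distrib_left lookup_frag_cmul of_int_mult mult.assoc)
  also have "\<dots> = of_int n * laurent_eval f u v"
    by (simp only: laurent_eval_superset [OF finite_keys subset_refl])
  finally show ?thesis .
qed

lemma laurent_eval_zero: "laurent_eval 0 u v = 0"
  by (simp add: laurent_eval_def)

lemma laurent_eval_sum:
  "laurent_eval (\<Sum>x\<in>T. frag_cmul (n x) (g x)) u v = (\<Sum>x\<in>T. of_int (n x) * laurent_eval (g x) u v)"
proof (induction T rule: infinite_finite_induct)
  case (insert x T)
  then show ?case by (simp add: laurent_eval_add laurent_eval_cmul)
qed (simp_all add: laurent_eval_zero)

lemma laurent_eval_single:
  "laurent_eval (Poly_Mapping.single (i, j) 1) u v = u powi i * v powi j"
  by (simp add: laurent_eval_def)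

text \<open>
  Multiplying the difference of two expansions by a power of \<open>u * v\<close> turns it into a polynomial
  relation between \<open>u\<close> and \<open>v\<close>.
\<close>

lemma laurent_eval_inject:
  fixes u v :: "'a::field"
  assumes "independent_pair u v" and "u \<noteq> 0" "v \<noteq> 0"
    and "laurent_eval f u v = laurent_eval g u v"
  shows "f = g"
proof -
  define h where "h = f - g"
  have f: "f = h + g" by (simp add: h_def)
  with assms(4) have zero: "laurent_eval h u v = 0"
    by (simp add: laurent_eval_add)
  \<comment> \<open>A crude bound for the absolute values of all exponents.\<close>
  define s where "s = nat (\<Sum>k\<in>Poly_Mapping.keys h. \<bar>fst k\<bar> + \<bar>snd k\<bar>)"
  define N where "N = 2 * s + 1"
  let ?e = "\<lambda>(i, j). (int i - int s, int j - int s)"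
  have bound: "\<bar>fst k\<bar> + \<bar>snd k\<bar> \<le> int s" if "k \<in> Poly_Mapping.keys h" for k
    using that member_le_sum [of k "Poly_Mapping.keys h" "\<lambda>k. \<bar>fst k\<bar> + \<bar>snd k\<bar>"]
      sum_nonneg [of "Poly_Mapping.keys h" "\<lambda>k. \<bar>fst k\<bar> + \<bar>snd k\<bar>"]
    by (simp add: s_def)
  have keys: "Poly_Mapping.keys h \<subseteq> ?e ` ({..<N} \<times> {..<N})"
  proof
    fix k
    assume "k \<in> Poly_Mapping.keys h"
    from bound [OF this] have "k = ?e (nat (fst k + int s), nat (snd k + int s))"
      and "nat (fst k + int s) < N" "nat (snd k + int s) < N"
      by (auto simp: N_def prod_eq_iff)
    then show "k \<in> ?e ` ({..<N} \<times> {..<N})" by blast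
  qed
  have inj: "inj_on ?e ({..<N} \<times> {..<N})"
    by (auto simp: inj_on_def)
  define F where "F i j = Poly_Mapping.lookup h (int i - int s, int j - int s)" for i j
  have "0 = laurent_eval h u v * u ^ s * v ^ s"
    by (simp add: zero)
  also have "laurent_eval h u v = (\<Sum>(i, j)\<in>{..<N} \<times> {..<N}.
      of_int (F i j) * u powi (int i - int s) * v powi (int j - int s))"
    by (subst laurent_eval_superset [OF _ keys], simp, subst sum.reindex [OF inj])
      (simp add: F_def case_prod_unfold)
  also have "\<dots> * u ^ s * v ^ s = (\<Sum>(i, j)\<in>{..<N} \<times> {..<N}. of_int (F i j) * u ^ i * v ^ j)"
    unfolding sum_distrib_right
    by (intro sum.cong refl)
      (simp add: assms(2,3) power_int_diff field_simps split: prod.split)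
  finally have "(\<Sum>i<N. \<Sum>j<N. of_int (F i j) * u ^ i * v ^ j) = 0"
    by (simp add: sum.cartesian_product)
  from independent_pairD [OF assms(1) this] have F: "F i j = 0" if "i < N" "j < N" for i j
    using that by blast
  have "Poly_Mapping.keys h = {}"
  proof (rule ccontr)
    assume "Poly_Mapping.keys h \<noteq> {}"
    then obtain k where k: "k \<in> Poly_Mapping.keys h" by blast
    with keys obtain i j where "i < N" "j < N" "k = ?e (i, j)" by blast
    with F [of i j] k show False by (simp add: F_def in_keys_iff)
  qed
  then show ?thesis by (simp add: f)
qed

lemma positive_laurent_expansion:
  assumes "x \<in> additive_closure (laurent_monomials u v S)"
  shows "\<exists>f. x = laurent_eval f u v \<and> Poly_Mapping.keys f \<subseteq> S \<and>
    (\<forall>k\<in>Poly_Mapping.keys f. Poly_Mapping.lookup f k > 0)"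
  using assms
proof induction
  case (base x)
  then obtain i j where "(i, j) \<in> S" "x = u powi i * v powi j"
    by (auto simp: laurent_monomials_def)
  then show ?case
    by (intro exI [of _ "Poly_Mapping.single (i, j) 1"]) (simp add: laurent_eval_single)
next
  case (add x y)
  from add.IH(1) obtain f where f: "x = laurent_eval f u v" "Poly_Mapping.keys f \<subseteq> S"
      "\<forall>k\<in>Poly_Mapping.keys f. Poly_Mapping.lookup f k > 0"
    by (elim exE conjE)
  from add.IH(2) obtain g where g: "y = laurent_eval g u v" "Poly_Mapping.keys g \<subseteq> S"
      "\<forall>k\<in>Poly_Mapping.keys g. Poly_Mapping.lookup g k > 0"
    by (elim exE conjE)
  have "Poly_Mapping.lookup (f + g) k > 0" if "k \<in> Poly_Mapping.keys (f + g)" for k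
  proof -
    have "k \<in> Poly_Mapping.keys f \<or> k \<in> Poly_Mapping.keys g"
      using subsetD [OF keys_add that] by simp
    moreover have "Poly_Mapping.lookup f k \<ge> 0"
      using f(3) by (cases "k \<in> Poly_Mapping.keys f") (simp_all add: less_imp_le not_in_keys_iff_lookup_eq_zero)
    moreover have "Poly_Mapping.lookup g k \<ge> 0"
      using g(3) by (cases "k \<in> Poly_Mapping.keys g") (simp_all add: less_imp_le not_in_keys_iff_lookup_eq_zero)
    ultimately show ?thesis
      using f(3) g(3) unfolding lookup_add by (metis add_pos_nonneg add_nonneg_pos)
  qed
  moreover have "Poly_Mapping.keys (f + g) \<subseteq> S"
    using f(2) g(2) keys_add [of f g] by (meson Un_least order_trans)
  ultimately show ?case
    using f(1) g(1) laurent_eval_add by metis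
qed

section \<open>Bases and the additive semigroups they generate\<close>

lemma additive_closure_pos_scale:
  fixes x :: "'a::comm_ring_1"
  assumes "x \<in> additive_closure S" and "n > 0"
  shows "of_int n * x \<in> additive_closure S"
proof -
  have "of_nat (Suc k) * x \<in> additive_closure S" for k
  proof (induction k)
    case (Suc k)
    then have "of_nat (Suc k) * x + x \<in> additive_closure S"
      using assms(1) by (rule additive_closure.add)
    then show ?case by (simp add: algebra_simps)
  qed (simp add: assms(1))
  from this [of "nat n - 1"] assms(2) show ?thesis by simp
qed

lemma positive_combinations_eq_additive_closure:
  fixes B :: "'a::comm_ring_1 set"
  shows "positive_combinations B = additive_closure B"
proof (intro equalityI subsetI)
  fix x
  assume "x \<in> positive_combinations B"
  then obtain T u where T: "finite T" "T \<noteq> {}" "T \<subseteq> B" "\<forall>v\<in>T. u v > 0"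
    and x: "x = (\<Sum>v\<in>T. of_int (u v) * v)"
    by (auto simp: positive_combinations_def)
  from T have "(\<Sum>v\<in>T. of_int (u v) * v) \<in> additive_closure B"
  proof (induction T rule: finite_ne_induct)
    case (singleton v)
    then show ?case by (simp add: additive_closure_pos_scale additive_closure.base)
  next
    case (insert v T)
    then show ?case
      by (auto intro!: additive_closure.add additive_closure_pos_scale intro: additive_closure.base)
  qed
  then show "x \<in> additive_closure B" by (simp add: x)
next
  fix x
  assume "x \<in> additive_closure B"
  then show "x \<in> positive_combinations B"
  proof induction
    case (base x)
    then show ?case
      unfolding positive_combinations_def
      by (intro CollectI exI [of _ "{x}"] exI [of _ "\<lambda>_. 1"]) simp
  next
    case (add x y)
    then obtain T u T' u' where T: "finite T" "T \<noteq> {}" "T \<subseteq> B" "\<forall>v\<in>T. u v > 0"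
        and x: "x = (\<Sum>v\<in>T. of_int (u v) * v)"
      and T': "finite T'" "T' \<noteq> {}" "T' \<subseteq> B" "\<forall>v\<in>T'. u' v > 0"
        and y: "y = (\<Sum>v\<in>T'. of_int (u' v) * v)"
      by (auto simp: positive_combinations_def)
    define w where "w v = (if v \<in> T then u v else 0) + (if v \<in> T' then u' v else 0)" for v
    have "x = (\<Sum>v\<in>T \<union> T'. of_int (if v \<in> T then u v else 0) * v)"
      unfolding x using T(1) T'(1) by (intro sum.mono_neutral_cong_left) auto
    moreover have "y = (\<Sum>v\<in>T \<union> T'. of_int (if v \<in> T' then u' v else 0) * v)"
      unfolding y using T(1) T'(1) by (intro sum.mono_neutral_cong_left) auto
    ultimately have "x + y = (\<Sum>v\<in>T \<union> T'. of_int (w v) * v)"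
      by (simp add: w_def distrib_right sum.distrib)
    moreover have "\<forall>v\<in>T \<union> T'. w v > 0"
      using T(4) T'(4) by (fastforce simp: w_def)
    ultimately show ?case
      unfolding positive_combinations_def using T(1-3) T'(1-3)
      by (intro CollectI exI [of _ "T \<union> T'"] exI [of _ w]) auto
  qed
qed

text \<open>
  This is what makes a basis element indecomposable in the additive closure of the basis: coordinates
  cannot cancel there, and each summand contributes a positive one.
\<close>

lemma representation_additive_closure:
  fixes B :: "'a::comm_ring_1 set"
  assumes "int_mod.independent B" and "x \<in> additive_closure B"
  shows "x \<in> int_mod.span B \<and> (\<forall>b. int_mod.representation B x b \<ge> 0) \<and>
    (\<exists>b. int_mod.representation B x b > 0)"
  using assms(2)
proof induction
  case (base x)
  then show ?case
    using int_mod.representation_basis [OF assms(1)] by (auto intro: int_mod.span_base)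
next
  case (add x y)
  then have "int_mod.representation B (x + y) =
      (\<lambda>b. int_mod.representation B x b + int_mod.representation B y b)"
    using int_mod.representation_add [OF assms(1)] by blast
  with add show ?case
    by (auto intro: int_mod.span_add) (metis add_pos_nonneg)
qed

text \<open>
  If \<open>b\<close> were a sum of two elements of the closure, each of them would have a positive integer
  coordinate, necessarily at \<open>b\<close>; then the coordinate of \<open>b\<close> at itself would be at least
  \<open>2\<close>.
\<close>

lemma additive_closure_basis_subset:
  fixes B B' :: "'a::comm_ring_1 set"
  assumes "int_mod.independent B" and "additive_closure B = additive_closure B'"
  shows "B \<subseteq> B'"
proof
  fix b
  assume b: "b \<in> B"
  then have "b \<in> additive_closure B'"
    using assms(2) by (auto intro: additive_closure.base)
  then show "b \<in> B'"
  proof cases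
    case (add x y)
    let ?R = "int_mod.representation B"
    have x: "x \<in> int_mod.span B \<and> (\<forall>b. ?R x b \<ge> 0) \<and> (\<exists>b. ?R x b > 0)"
      and y: "y \<in> int_mod.span B \<and> (\<forall>b. ?R y b \<ge> 0) \<and> (\<exists>b. ?R y b > 0)"
      using add assms by (auto intro!: representation_additive_closure)
    have sum: "?R x b' + ?R y b' = (if b' = b then 1 else 0)" for b'
      using int_mod.representation_add [OF assms(1), of y x]
        int_mod.representation_basis [OF assms(1) b] x y add(1) by metis
    have "?R x b > 0"
      using x sum y by (metis add_nonneg_eq_0_iff less_irrefl)
    moreover have "?R y b > 0"
      using x sum y by (metis add_nonneg_eq_0_iff less_irrefl)
    ultimately show ?thesis
      using sum [of b] by simp
  qed
qed

lemma additive_closure_basis_unique: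
  fixes B B' :: "'a::comm_ring_1 set"
  assumes "int_mod.independent B" "int_mod.independent B'"
    and "additive_closure B = additive_closure B'"
  shows "B = B'"
  using additive_closure_basis_subset assms by (metis subset_antisym)

section \<open>The canonical basis\<close>

lemma cluster_monomials_eq_adjacent_monomials:
  "cluster_monomials b c = adjacent_monomials (cluster_var b c)"
  by (simp add: cluster_monomials_def adjacent_monomials_def)

lemma adjacent_monomials_shift: "adjacent_monomials (\<lambda>k. z (k + d)) = adjacent_monomials z"
proof (intro equalityI subsetI)
  fix x
  assume "x \<in> adjacent_monomials (\<lambda>k. z (k + d))"
  then obtain m p q where "x = z (m + d) ^ p * z (m + d + 1) ^ q"
    by (auto simp: adjacent_monomials_def ac_simps)
  then show "x \<in> adjacent_monomials z"
    unfolding adjacent_monomials_def by blast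
next
  fix x
  assume "x \<in> adjacent_monomials z"
  then obtain m p q where "x = z m ^ p * z (m + 1) ^ q"
    by (auto simp: adjacent_monomials_def)
  then have "x = z ((m - d) + d) ^ p * z ((m - d + 1) + d) ^ q"
    by simp
  then show "x \<in> adjacent_monomials (\<lambda>k. z (k + d))"
    unfolding adjacent_monomials_def by blast
qed

lemma cluster_vars_exchange_sequence:
  assumes "b > 0" "c > 0" and "b * c \<le> 3"
  obtains d e where "exchange_sequence (\<lambda>k. cluster_var b c (k + d)) e" and "e \<le> 3"
proof (cases "b = 1")
  case True
  have "exchange_sequence (\<lambda>k. cluster_var b c (k + 1)) c"
    using cluster_var_exchange [of b c "k + 1" for k] True assms(2)
    by unfold_locales (auto simp: cluster_var_nonzero algebra_simps)
  with True assms(3) show ?thesis by (intro that) auto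
next
  case False
  then have "c = 1"
    using assms by (cases "c \<ge> 2") (use mult_le_mono [of 2 b 2 c] in auto)
  have "exchange_sequence (\<lambda>k. cluster_var b c (k + 0)) b"
    using cluster_var_exchange [of b c] \<open>c = 1\<close> assms(1)
    by unfold_locales (auto simp: cluster_var_nonzero)
  with \<open>c = 1\<close> assms(3) show ?thesis by (intro that [of 0]) auto
qed

context
  fixes b c :: nat
  assumes finite_type: "b > 0" "c > 0" "b * c \<le> 3"
begin

abbreviation y :: "int \<Rightarrow> ratfun" where
  "y \<equiv> cluster_var b c"

lemma cluster_algebra_eq_span: "cluster_algebra b c = int_mod.span (cluster_monomials b c)"
proof -
  obtain d e where "exchange_sequence (\<lambda>k. y (k + d)) e" and "e \<le> 3"
    using cluster_vars_exchange_sequence [OF finite_type] .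
  from exchange_sequence.subring_generated_eq_span [OF this]
  have "subring_generated (range (\<lambda>k. y (k + d))) = int_mod.span (cluster_monomials b c)"
    by (simp add: adjacent_monomials_shift cluster_monomials_eq_adjacent_monomials)
  moreover have "range (\<lambda>k. y (k + d)) = range y"
    using fun.set_map [of y "\<lambda>k. k + d"] by (auto simp: image_def) (metis diff_add_cancel)
  ultimately show ?thesis
    by (simp add: cluster_algebra_def)
qed

lemma cluster_monomial_cases:
  assumes "w \<in> cluster_monomials b c"
  shows "(\<exists>p q. w = y m ^ p * y (m + 1) ^ q) \<or>
    w \<in> additive_closure (laurent_monomials (y m) (y (m + 1)) proper_exponents)"
proof -
  obtain d e where e: "exchange_sequence (\<lambda>k. y (k + d)) e" "e \<le> 3"
    using cluster_vars_exchange_sequence [OF finite_type] .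
  have "w \<in> adjacent_monomials (\<lambda>k. y (k + d))"
    using assms by (simp add: adjacent_monomials_shift cluster_monomials_eq_adjacent_monomials)
  from exchange_sequence.adjacent_monomial_cases [OF e this, of "m - d"] show ?thesis
    by (simp add: algebra_simps)
qed

lemma cluster_monomial_positive_expansion:
  assumes "w \<in> cluster_monomials b c"
  shows "w \<in> additive_closure (laurent_monomials (y m) (y (m + 1)) UNIV)"
  using cluster_monomial_cases [OF assms, of m]
proof
  assume "\<exists>p q. w = y m ^ p * y (m + 1) ^ q"
  then obtain p q where "w = y m powi int p * y (m + 1) powi int q"
    by auto
  then show ?thesis
    by (intro additive_closure.base) (auto simp: laurent_monomials_def intro: image_eqI [of _ _ "(int p, int q)"])
qed (erule additive_closure_mono, auto simp: laurent_monomials_def)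

text \<open>
  Among the Laurent expansions of the summands in the cluster of \<open>y m\<close> and \<open>y (m + 1)\<close>, only
  the one of the given cluster monomial contains its exponent vector: other monomials of the same
  cluster have other exponents, and monomials of other clusters have a negative exponent in each term.
\<close>

lemma coefficient_of_cluster_monomial:
  assumes "finite T" "T \<subseteq> cluster_monomials b c" and "y m ^ p * y (m + 1) ^ q \<in> T"
    and "(\<Sum>w\<in>T. of_int (n w) * w) = laurent_eval f (y m) (y (m + 1))"
  shows "Poly_Mapping.lookup f (int p, int q) = n (y m ^ p * y (m + 1) ^ q)"
proof -
  let ?v = "y m ^ p * y (m + 1) ^ q"
  have "\<exists>g. w = laurent_eval g (y m) (y (m + 1)) \<and>
      Poly_Mapping.lookup g (int p, int q) = (if w = ?v then 1 else 0)" if "w \<in> T" for w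
  proof (cases "\<exists>p q. w = y m ^ p * y (m + 1) ^ q")
    case True
    show ?thesis
    proof (cases "w = ?v")
      case True
      then show ?thesis
        by (intro exI [of _ "Poly_Mapping.single (int p, int q) 1"]) (simp add: laurent_eval_single)
    next
      case False
      from True obtain p' q' where "w = y m ^ p' * y (m + 1) ^ q'" by blast
      with False show ?thesis
        by (intro exI [of _ "Poly_Mapping.single (int p', int q') 1"])
          (auto simp: laurent_eval_single lookup_single when_def)
    qed
  next
    case False
    with cluster_monomial_cases [of w m] that assms(2)
    have "w \<in> additive_closure (laurent_monomials (y m) (y (m + 1)) proper_exponents)"
      by blast
    then obtain g where "w = laurent_eval g (y m) (y (m + 1))"
      "Poly_Mapping.keys g \<subseteq> proper_exponents"
      using positive_laurent_expansion by blast
    moreover have "(int p, int q) \<notin> proper_exponents"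
      by (simp add: proper_exponents_def)
    ultimately show ?thesis
      using False by (intro exI [of _ g]) (auto simp: in_keys_iff)
  qed
  then obtain g where g: "\<And>w. w \<in> T \<Longrightarrow> w = laurent_eval (g w) (y m) (y (m + 1))"
    "\<And>w. w \<in> T \<Longrightarrow> Poly_Mapping.lookup (g w) (int p, int q) = (if w = ?v then 1 else 0)"
    by metis
  have "laurent_eval (\<Sum>w\<in>T. frag_cmul (n w) (g w)) (y m) (y (m + 1)) =
      laurent_eval f (y m) (y (m + 1))"
    unfolding laurent_eval_sum assms(4) [symmetric] using g(1) by (intro sum.cong refl) metis
  then have "f = (\<Sum>w\<in>T. frag_cmul (n w) (g w))"
    using laurent_eval_inject [OF independent_adjacent_cluster_vars cluster_var_nonzero cluster_var_nonzero]
    by metis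
  then have "Poly_Mapping.lookup f (int p, int q) = (\<Sum>w\<in>T. n w * (if w = ?v then 1 else 0))"
    by (simp add: lookup_sum g(2))
  also have "\<dots> = n ?v"
    using assms(1,3) by (simp add: if_distrib cong: if_cong)
  finally show ?thesis .
qed

lemma cluster_monomials_independent: "int_mod.independent (cluster_monomials b c)"
  unfolding int_mod.independent_explicit_module
proof (intro allI impI)
  fix T n v
  assume T: "finite T" "T \<subseteq> cluster_monomials b c"
    and zero: "(\<Sum>w\<in>T. of_int (n w) * w) = 0" and v: "v \<in> T"
  then obtain m p q where mpq: "v = y m ^ p * y (m + 1) ^ q"
    by (auto simp: cluster_monomials_def)
  have "(\<Sum>w\<in>T. of_int (n w) * w) = laurent_eval 0 (y m) (y (m + 1))"
    using zero by (simp add: laurent_eval_zero)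
  from coefficient_of_cluster_monomial [OF T _ this, of p q] v mpq show "n v = 0"
    by simp
qed

text \<open>
  Positive combinations are nonzero because they are positive for the field order, as all cluster
  variables are. For the converse, the coordinate of \<open>x\<close> at a cluster monomial is read off from
  the positive Laurent expansion of \<open>x\<close> in the cluster of that monomial.
\<close>

lemma positive_element_iff:
  "positive_element b c x \<longleftrightarrow> x \<in> additive_closure (cluster_monomials b c)"
proof
  assume x: "x \<in> additive_closure (cluster_monomials b c)"
  then have "x \<in> cluster_algebra b c"
    unfolding cluster_algebra_eq_span
    by induction (auto intro: int_mod.span_base int_mod.span_add)
  moreover have "x > 0"
    using x
  proof induction
    case (base w)
    then show ?case
      by (auto simp: cluster_monomials_def intro!: mult_pos_pos zero_less_power cluster_var_greater_zero)
  qed (rule add_pos_pos)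
  moreover have "x \<in> additive_closure (laurent_monomials (y m) (y (m + 1)) UNIV)" for m
    using x
    by induction (auto intro: cluster_monomial_positive_expansion additive_closure.add)
  ultimately show "positive_element b c x"
    unfolding positive_element_def using positive_laurent_expansion by blast
next
  assume x: "positive_element b c x"
  let ?B = "cluster_monomials b c"
  define n where "n = int_mod.representation ?B x"
  define T where "T = {w. n w \<noteq> 0}"
  have span: "x \<in> int_mod.span ?B"
    using x by (simp add: positive_element_def cluster_algebra_eq_span)
  have T: "finite T" "T \<subseteq> ?B"
    unfolding T_def n_def
    using int_mod.finite_representation int_mod.representation_ne_zero by auto
  have sum: "x = (\<Sum>w\<in>T. of_int (n w) * w)"
    using int_mod.sum_nonzero_representation_eq [OF cluster_monomials_independent span]
    by (simp add: T_def n_def)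
  have "n v > 0" if "v \<in> T" for v
  proof -
    from that T(2) obtain m p q where mpq: "v = y m ^ p * y (m + 1) ^ q"
      by (auto simp: cluster_monomials_def)
    obtain f where f: "x = laurent_eval f (y m) (y (m + 1))"
        "\<forall>k\<in>Poly_Mapping.keys f. Poly_Mapping.lookup f k > 0"
      using x unfolding positive_element_def by blast
    from coefficient_of_cluster_monomial [OF T _ trans [OF sum [symmetric] f(1)], of p q] that
    have "Poly_Mapping.lookup f (int p, int q) = n v"
      by (simp add: mpq)
    moreover have "n v \<noteq> 0"
      using that by (simp add: T_def)
    ultimately show ?thesis
      using f(2) by (metis in_keys_iff)
  qed
  moreover have "T \<noteq> {}"
    using x sum by (auto simp: positive_element_def)
  ultimately have "x \<in> positive_combinations ?B"
    unfolding positive_combinations_def using T sum by blast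
  then show "x \<in> additive_closure ?B"
    by (simp add: positive_combinations_eq_additive_closure)
qed

end

theorem theorem2p7:
  fixes b c :: nat and B :: "ratfun set"
  assumes "b > 0" and "c > 0" and "b * c \<le> 3"
  shows "is_canonical_basis b c B \<longleftrightarrow> B = cluster_monomials b c"
proof -
  have "{x. positive_element b c x} = additive_closure (cluster_monomials b c)"
    using positive_element_iff [OF assms] by blast
  then show ?thesis
    using cluster_monomials_independent [OF assms] cluster_algebra_eq_span [OF assms]
      additive_closure_basis_unique [of B "cluster_monomials b c"]
    by (auto simp: is_canonical_basis_def is_int_basis_def positive_combinations_eq_additive_closure)
qed

end
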